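(* Let $d\in\mathcal{D}$ be a destination, let $\mathcal{Z}_d=\{\boldsymbol{z}_d^1,\dots,\boldsymbol{z}_d^{n_{\texttt{comb}}}\}$ be the set of all $n_{\texttt{comb}}=2^{n_O}$ binary vectors in $\{0,1\}^{n_O}$, let $I_d:\mathcal{Z}_d\to\mathbb{R}$ be the coverage function of $d$, and let $\tilde I_d$ be the function on the convex hull of $\mathcal{Z}_d$ defined by the parametric linear program $$\tilde I_d(\boldsymbol{z}_d)=\max\Big\{\sum_{i=1}^{n_{\texttt{comb}}}\alpha_d^i\, I_d(\boldsymbol{z}_d^i)\;:\;\boldsymbol{\alpha}_d\in\mathbb{R}_{+}^{n_{\texttt{comb}}},\ \sum_{i=1}^{n_{\texttt{comb}}}\alpha_d^i\,\boldsymbol{z}_d^i=\boldsymbol{z}_d,\ \sum_{i=1}^{n_{\texttt{comb}}}\alpha_d^i=1\Big\}.$$ Then for all integer points $\boldsymbol{z}_d\in\mathcal{Z}_d$, $$I_d(\boldsymbol{z}_d)=\tilde I_d(\boldsymbol{z}_d).$$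
   Context: $\mathcal{O}$ is a finite set of $n_O$ origins and $\mathcal{D}$ a finite set of destinations. For a destination $d$, a vector $\boldsymbol{z}_d=(z_{od})_{o\in\mathcal{O}}\in\{0,1\}^{n_O}$ records which origins are connected to $d$ by a short path ($z_{od}=1$) or by a long path ($z_{od}=0$). The vectors $\boldsymbol{z}_d^1,\dots,\boldsymbol{z}_d^{n_{\texttt{comb}}}$ are pairwise distinct and enumerate all of $\{0,1\}^{n_O}$. The coverage function $I_d$ has the form $$I_d(\boldsymbol{z})=\sum_{s\subseteq\mathcal{O}_d}\beta_s\prod_{i\in s}z_{id}\prod_{j\in\mathcal{O}_d\setminus s}(1-z_{jd}),$$ where $\mathcal{O}_d\subseteq\mathcal{O}$ is the set of origins that form a commodity with $d$ and $\beta_s$ is a given number (the count of unique items stored at the set $s$ of origins). $\mathbb{R}_+$ denotes the nonnegative reals. *)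

theory Defs
  imports "HOL-Analysis.Analysis"
begin

text \<open>Origins form a finite type, so that vectors indexed by origins live in
  \<open>real ^ 'o\<close> and \<open>n\<^sub>O = CARD('o)\<close>.\<close>

definition n_comb :: "'o::finite itself \<Rightarrow> nat" where
  "n_comb _ = 2 ^ CARD('o)"

definition binary_vectors :: "(real ^ 'o::finite) set" where
  "binary_vectors = {z. \<forall>i. z $ i \<in> {0, 1}}"

definition coverage :: "'o::finite set \<Rightarrow> ('o set \<Rightarrow> real) \<Rightarrow> real ^ 'o \<Rightarrow> real" where
  "coverage Od \<beta> z =
     (\<Sum>s\<in>Pow Od. \<beta> s * (\<Prod>i\<in>s. z $ i) * (\<Prod>j\<in>Od - s. 1 - z $ j))"

definition lp_feasible :: "(nat \<Rightarrow> real ^ 'o::finite) \<Rightarrow> real ^ 'o \<Rightarrow> (nat \<Rightarrow> real) set" where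
  "lp_feasible zs x =
     {\<alpha>. (\<forall>i\<in>{1..n_comb TYPE('o)}. 0 \<le> \<alpha> i) \<and>
         (\<Sum>i = 1..n_comb TYPE('o). \<alpha> i *\<^sub>R zs i) = x \<and>
         (\<Sum>i = 1..n_comb TYPE('o). \<alpha> i) = 1}"

definition lp_values ::
    "(real ^ 'o::finite \<Rightarrow> real) \<Rightarrow> (nat \<Rightarrow> real ^ 'o) \<Rightarrow> real ^ 'o \<Rightarrow> real set" where
  "lp_values I zs x = (\<lambda>\<alpha>. \<Sum>i = 1..n_comb TYPE('o). \<alpha> i * I (zs i)) ` lp_feasible zs x"

text \<open>\<open>GREATEST\<close> denotes an attained maximum (\<open>Max\<close> would require a finite set of values).
  It is a genuine value only where the maximum exists; the lemma below shows that this is the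
  case on the whole convex hull, the intended domain.\<close>

definition parametric_lp ::
    "(real ^ 'o::finite \<Rightarrow> real) \<Rightarrow> (nat \<Rightarrow> real ^ 'o) \<Rightarrow> real ^ 'o \<Rightarrow> real" where
  "parametric_lp I zs x = (GREATEST v. v \<in> lp_values I zs x)"

lemma parametric_lp_is_max:
  fixes I :: "real ^ 'o::finite \<Rightarrow> real" and zs :: "nat \<Rightarrow> real ^ 'o"
  assumes inj: "inj_on zs {1..n_comb TYPE('o)}"
    and x: "x \<in> convex hull (zs ` {1..n_comb TYPE('o)})"
  shows "parametric_lp I zs x \<in> lp_values I zs x"
    and "v \<in> lp_values I zs x \<Longrightarrow> v \<le> parametric_lp I zs x"
proof -
  define N where "N = {1..n_comb TYPE('o)}"
  define g where "g = (\<lambda>i. (zs i, I (zs i)))"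
  have injz: "inj_on zs N" using inj by (simp add: N_def)
  have injg: "inj_on g N" using injz by (auto simp: inj_on_def g_def)
  have finN: "finite N" by (simp add: N_def)
  have hull: "convex hull (h ` N) =
      {y. \<exists>\<alpha>. (\<forall>i\<in>N. 0 \<le> \<alpha> i) \<and> sum \<alpha> N = 1 \<and> (\<Sum>i\<in>N. \<alpha> i *\<^sub>R h i) = y}"
    if h: "inj_on h N" for h :: "nat \<Rightarrow> 'b::real_vector"
  proof (intro set_eqI iffI)
    fix y assume "y \<in> convex hull (h ` N)"
    then obtain u where u: "\<forall>x\<in>h ` N. 0 \<le> u x" "sum u (h ` N) = 1"
        "(\<Sum>x\<in>h ` N. u x *\<^sub>R x) = y"
      using convex_hull_finite[of "h ` N"] finN by auto
    then show "y \<in> {y. \<exists>\<alpha>. (\<forall>i\<in>N. 0 \<le> \<alpha> i) \<and> sum \<alpha> N = 1 \<and> (\<Sum>i\<in>N. \<alpha> i *\<^sub>R h i) = y}"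
      using h by (intro CollectI exI[of _ "u \<circ> h"]) (auto simp: sum.reindex o_def)
  next
    fix y assume "y \<in> {y. \<exists>\<alpha>. (\<forall>i\<in>N. 0 \<le> \<alpha> i) \<and> sum \<alpha> N = 1 \<and> (\<Sum>i\<in>N. \<alpha> i *\<^sub>R h i) = y}"
    then show "y \<in> convex hull (h ` N)"
      using convex_sum[OF finN convex_convex_hull[of "h ` N"]] by (auto simp: hull_inc)
  qed
  have vals: "lp_values I zs x = {v. (x, v) \<in> convex hull (g ` N)}"
    unfolding hull[OF injg]
    by (auto simp: lp_values_def lp_feasible_def N_def g_def prod_eq_iff fst_sum snd_sum image_iff)
  have "compact (convex hull (g ` N))"
    using finN by (simp add: finite_imp_compact_convex_hull)
  moreover have "closed ({x} \<times> (UNIV :: real set))" by (simp add: closed_Times)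
  ultimately have "compact (convex hull (g ` N) \<inter> {x} \<times> UNIV)"
    by (rule compact_Int_closed)
  then have "compact (snd ` (convex hull (g ` N) \<inter> {x} \<times> UNIV))"
    by (intro compact_continuous_image continuous_intros)
  moreover have "snd ` (convex hull (g ` N) \<inter> {x} \<times> UNIV) = lp_values I zs x"
    unfolding vals by force
  ultimately have comp: "compact (lp_values I zs x)" by simp
  have "lp_values I zs x \<noteq> {}"
    using x unfolding N_def[symmetric] hull[OF injz]
    by (auto simp: lp_values_def lp_feasible_def N_def)
  then obtain m where m: "m \<in> lp_values I zs x" "\<forall>v\<in>lp_values I zs x. v \<le> m"
    using compact_attains_sup[OF comp] by blast
  have "parametric_lp I zs x = m"
    unfolding parametric_lp_def using m by (intro Greatest_equality) auto
  then show "parametric_lp I zs x \<in> lp_values I zs x"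
    and "v \<in> lp_values I zs x \<Longrightarrow> v \<le> parametric_lp I zs x"
    using m by auto
qed

end

theory Submission
  imports Defs
begin

text \<open>A binary vector is a vertex of the unit cube, so it is a convex combination of points of the
  cube only in the trivial way, with all the weight on copies of itself. Hence at an integer point
  every feasible solution of the linear program has the same objective value, namely the value of
  the coverage function there. Since the point is itself one of the enumerated vectors, a feasible
  solution exists, and the maximum is taken over a single number.\<close>

text \<open>Each coordinate of a vertex of the cube is the least or the greatest value that the coordinate
  takes on the cube, and a weighted mean attains such a bound only if every term of positive weight
  does.\<close>

lemma convex_combination_eq_binary_vector:
  fixes w :: "'i \<Rightarrow> real ^ 'o::finite" and \<alpha> :: "'i \<Rightarrow> real"
  assumes fin: "finite N"
    and nonneg: "\<And>i. i \<in> N \<Longrightarrow> 0 \<le> \<alpha> i"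
    and total: "sum \<alpha> N = 1"
    and comb: "(\<Sum>i\<in>N. \<alpha> i *\<^sub>R w i) = z"
    and cube: "\<And>i j. i \<in> N \<Longrightarrow> w i $ j \<in> {0..1}"
    and z: "z \<in> binary_vectors"
    and k: "k \<in> N" "\<alpha> k \<noteq> 0"
  shows "w k = z"
proof (rule vec_eq_iff[THEN iffD2], rule allI)
  fix j
  have mean: "(\<Sum>i\<in>N. \<alpha> i * w i $ j) = z $ j"
    using arg_cong[OF comb, of "\<lambda>v. v $ j"] by (simp add: sum_component)
  consider "z $ j = 0" | "z $ j = 1"
    using z by (auto simp: binary_vectors_def)
  then show "w k $ j = z $ j"
  proof cases
    case 1
    then have "\<forall>i\<in>N. \<alpha> i * w i $ j = 0"
      using mean nonneg cube
      by (subst sum_nonneg_eq_0_iff[OF fin, symmetric]) auto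
    then show ?thesis using k 1 by auto
  next
    case 2
    have "(\<Sum>i\<in>N. \<alpha> i * (1 - w i $ j)) = 0"
      using mean total 2 by (simp add: right_diff_distrib sum_subtractf)
    then have "\<forall>i\<in>N. \<alpha> i * (1 - w i $ j) = 0"
      using nonneg cube
      by (subst sum_nonneg_eq_0_iff[OF fin, symmetric]) auto
    then show ?thesis using k 2 by auto
  qed
qed

lemma lp_values_binary_vector:
  fixes I :: "real ^ 'o::finite \<Rightarrow> real" and zs :: "nat \<Rightarrow> real ^ 'o"
  assumes enum: "zs ` {1..n_comb TYPE('o)} = binary_vectors"
    and z: "z \<in> binary_vectors"
  shows "lp_values I zs z = {I z}"
proof -
  define N where "N = {1..n_comb TYPE('o)}"
  have fin: "finite N" by (simp add: N_def)
  have cube: "zs i $ j \<in> {0..1}" if "i \<in> N" for i j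
  proof -
    have "zs i \<in> binary_vectors" using enum that by (auto simp: N_def)
    then have "zs i $ j \<in> {0, 1}" by (simp add: binary_vectors_def)
    then show ?thesis by auto
  qed
  have value_eq: "(\<Sum>i\<in>N. \<alpha> i * I (zs i)) = I z" if "\<alpha> \<in> lp_feasible zs z" for \<alpha>
  proof -
    have feas: "\<And>i. i \<in> N \<Longrightarrow> 0 \<le> \<alpha> i" "sum \<alpha> N = 1" "(\<Sum>i\<in>N. \<alpha> i *\<^sub>R zs i) = z"
      using that by (auto simp: lp_feasible_def N_def)
    have "\<alpha> i * I (zs i) = \<alpha> i * I z" if "i \<in> N" for i
      using convex_combination_eq_binary_vector[OF fin feas cube z that]
      by (cases "\<alpha> i = 0") auto
    then have "(\<Sum>i\<in>N. \<alpha> i * I (zs i)) = (\<Sum>i\<in>N. \<alpha> i) * I z"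
      unfolding sum_distrib_right by (rule sum.cong[OF refl])
    then show ?thesis by (simp add: feas)
  qed
  obtain k where k: "k \<in> N" "zs k = z"
    using z unfolding enum[symmetric] N_def by blast
  have "(\<lambda>i. if i = k then 1 else 0) \<in> lp_feasible zs z"
    using k fin unfolding lp_feasible_def N_def[symmetric]
    by (simp add: if_distrib[of "\<lambda>c. c *\<^sub>R _"] cong: if_cong)
  then show ?thesis
    using value_eq by (auto simp: lp_values_def N_def intro!: rev_image_eqI)
qed

theorem proposition1:
  fixes \<D> :: "'d set"
    and d :: 'd
    and \<O> :: "'d \<Rightarrow> 'o::finite set"
    and \<beta> :: "'o set \<Rightarrow> real"
    and zs :: "'d \<Rightarrow> nat \<Rightarrow> real ^ 'o"
  assumes "finite \<D>"
    and "d \<in> \<D>"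
    and "bij_betw (zs d) {1..n_comb TYPE('o)} binary_vectors"
  shows "\<forall>z\<in>binary_vectors.
    coverage (\<O> d) \<beta> z = parametric_lp (coverage (\<O> d) \<beta>) (zs d) z"
proof
  fix z :: "real ^ 'o"
  assume z: "z \<in> binary_vectors"
  have "lp_values (coverage (\<O> d) \<beta>) (zs d) z = {coverage (\<O> d) \<beta> z}"
    using lp_values_binary_vector[OF bij_betw_imp_surj_on[OF assms(3)] z] .
  then show "coverage (\<O> d) \<beta> z = parametric_lp (coverage (\<O> d) \<beta>) (zs d) z"
    unfolding parametric_lp_def by (auto intro!: Greatest_equality[symmetric])
qed

end
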